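(* Let $n \ge 1$ and let $B \subset \mathbb{R}^{n+1}$ be the image of a strictly-convex embedding of the closed disc $\mathbb{D}^{n+1}$ into $\mathbb{R}^{n+1}$, with boundary $n$-sphere $S = \partial B$. Let $\{v_1, \dots, v_{n+1}\}$ be an orthonormal basis of $\mathbb{R}^{n+1}$ such that $B$ is regular with respect to this basis and $B$ has no special corners with respect to this basis. Then $S$ inscribes an $(n+1)$-rhomb with direction $\{v_1, \dots, v_{n+1}\}$; that is, there exist a point $p \in \mathbb{R}^{n+1}$ and real numbers $\lambda_1, \dots, \lambda_{n+1} > 0$ such that $p + \lambda_i v_i \in S$ and $p - \lambda_i v_i \in S$ for all $i = 1, \dots, n+1$.
   Context: A subset $B \subset \mathbb{R}^{n+1}$ is strictly-convex if for all $x, y \in B$ every point of the straight line segment from $x$ to $y$, except possibly $x$ and $y$ themselves, lies in the interior of $B$. A strictly-convex embedding of $\mathbb{D}^{n+1}$ is a (topological) embedding of $\mathbb{D}^{n+1}$ into $\mathbb{R}^{n+1}$ whose image is strictly-convex (equivalently, the image $B$ is a compact strictly-convex set with non-empty interior). An $m$-rhomb in $\mathbb{R}^m$ is the convex hull of points $p \pm \lambda_i v_i$, $i = 1, \dots, m$, where $p \in \mathbb{R}^m$, $\{v_1, \dots, v_m\}$ is an orthonormal basis of $\mathbb{R}^m$ and $\lambda_i > 0$; the points $p \pm \lambda_i v_i$ are its vertices and $\{v_1, \dots, v_m\}$ is its direction. A set inscribes a polytope if it contains all of its vertices. For a basis vector $v_i$, $p_i$ denotes the orthogonal projection of $\mathbb{R}^{n+1}$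 onto the hyperplane $v_i^{\perp} \cong \mathbb{R}^n$. For non-empty $I \subset \{1, \dots, n+1\}$ with $k = |I| \le n$, $p_I$ is the composition of the (commuting) projections $p_i$, $i \in I$, i.e. the orthogonal projection onto the $(n+1-k)$-dimensional subspace $\{v_i : i \in I\}^{\perp} \cong \mathbb{R}^{n+1-k}$. The boundaries $\partial p_i(B)$ and $\partial p_I(B)$ are taken inside $v_i^\perp$ and $\{v_i : i \in I\}^\perp$ respectively. $B$ is regular with respect to the basis $\{v_1, \dots, v_{n+1}\}$ if there is no non-empty $I \subset \{1, \dots, n+1\}$ with $|I| \le n$ and no point $x \in B$ such that $p_i(x) \in \partial p_i(B)$ for all $i \in I$ but $p_I(x) \notin \partial p_I(B)$. A point $x \in B$ is a special corner of $B$ with respect to the basis $\{v_1, \dots, v_{n+1}\}$ if $p_i(x) \in \partial p_i(B)$ for all $i = 1, \dots, n+1$. *)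

theory Defs
  imports "HOL-Analysis.Analysis"
begin

definition strictly_convex :: "'a::euclidean_space set \<Rightarrow> bool" where
  "strictly_convex B \<longleftrightarrow> (\<forall>x\<in>B. \<forall>y\<in>B. open_segment x y \<subseteq> interior B)"

definition strictly_convex_embedding :: "('a::euclidean_space \<Rightarrow> 'a) \<Rightarrow> bool" where
  "strictly_convex_embedding f \<longleftrightarrow>
     embedding_map (top_of_set (cball 0 1)) euclidean f \<and> strictly_convex (f ` cball 0 1)"

definition orthonormal_basis :: "nat set \<Rightarrow> (nat \<Rightarrow> 'a::euclidean_space) \<Rightarrow> bool" where
  "orthonormal_basis J v \<longleftrightarrow>
     (\<forall>i\<in>J. \<forall>j\<in>J. v i \<bullet> v j = (if i = j then 1 else 0)) \<and> span (v ` J) = UNIV"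

text \<open>Meaningful only when \<open>W\<close> is a linear subspace, where such a \<open>y\<close> exists and is unique.\<close>

definition orth_proj :: "'a::euclidean_space set \<Rightarrow> 'a \<Rightarrow> 'a" where
  "orth_proj W x = (THE y. y \<in> W \<and> x - y \<in> W\<^sup>\<bottom>)"

definition proj :: "(nat \<Rightarrow> 'a::euclidean_space) \<Rightarrow> nat set \<Rightarrow> 'a \<Rightarrow> 'a" where
  "proj v I = orth_proj ((v ` I)\<^sup>\<bottom>)"

text \<open>The boundary is taken in the subspace \<open>(v ` I)\<^sup>\<bottom>\<close>; in the whole space every
  projected set would be its own boundary.\<close>

definition proj_boundary :: "(nat \<Rightarrow> 'a::euclidean_space) \<Rightarrow> nat set \<Rightarrow> 'a set \<Rightarrow> 'a set" where
  "proj_boundary v I B = top_of_set ((v ` I)\<^sup>\<bottom>) frontier_of (proj v I ` B)"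

definition regular_wrt :: "nat \<Rightarrow> (nat \<Rightarrow> 'a::euclidean_space) \<Rightarrow> 'a set \<Rightarrow> bool" where
  "regular_wrt n v B \<longleftrightarrow>
     \<not> (\<exists>I x. I \<subseteq> {1..n+1} \<and> I \<noteq> {} \<and> card I \<le> n \<and> x \<in> B \<and>
          (\<forall>i\<in>I. proj v {i} x \<in> proj_boundary v {i} B) \<and>
          proj v I x \<notin> proj_boundary v I B)"

definition special_corner :: "nat \<Rightarrow> (nat \<Rightarrow> 'a::euclidean_space) \<Rightarrow> 'a set \<Rightarrow> 'a \<Rightarrow> bool" where
  "special_corner n v B x \<longleftrightarrow>
     x \<in> B \<and> (\<forall>i\<in>{1..n+1}. proj v {i} x \<in> proj_boundary v {i} B)"

lemma orth_proj_eqI: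
  assumes "subspace W" "y \<in> W" "x - y \<in> W\<^sup>\<bottom>"
  shows "orth_proj W x = y"
  unfolding orth_proj_def
proof (rule the_equality)
  show "y \<in> W \<and> x - y \<in> W\<^sup>\<bottom>" using assms by simp
next
  fix z assume z: "z \<in> W \<and> x - z \<in> W\<^sup>\<bottom>"
  have "z - y \<in> W" using z assms by (simp add: subspace_diff)
  moreover have "(x - y) - (x - z) \<in> W\<^sup>\<bottom>"
    using z assms(3) by (blast intro: subspace_diff subspace_orthogonal_comp)
  then have "z - y \<in> W\<^sup>\<bottom>" by simp
  ultimately have "orthogonal (z - y) (z - y)" by (auto simp: orthogonal_comp_def)
  then show "z = y" by (simp add: orthogonal_def)
qed

lemma proj_eq:
  assumes "orthonormal_basis J v" "finite J" "I \<subseteq> J"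
  shows "proj v I x = x - (\<Sum>i\<in>I. (x \<bullet> v i) *\<^sub>R v i)"
  unfolding proj_def
proof (rule orth_proj_eqI)
  have fin: "finite I" using assms finite_subset by blast
  have on: "v i \<bullet> v j = (if i = j then 1 else 0)" if "i \<in> I" "j \<in> I" for i j
    using assms that unfolding orthonormal_basis_def by blast
  show "subspace ((v ` I)\<^sup>\<bottom>)" by (rule subspace_orthogonal_comp)
  have "v j \<bullet> (\<Sum>i\<in>I. (x \<bullet> v i) *\<^sub>R v i) = v j \<bullet> x" if "j \<in> I" for j
  proof -
    have "v j \<bullet> (\<Sum>i\<in>I. (x \<bullet> v i) *\<^sub>R v i) = (\<Sum>i\<in>I. if j = i then x \<bullet> v i else 0)"
      unfolding inner_sum_right using on that by (intro sum.cong) auto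
    then show ?thesis using that fin by (simp add: inner_commute)
  qed
  then show "x - (\<Sum>i\<in>I. (x \<bullet> v i) *\<^sub>R v i) \<in> (v ` I)\<^sup>\<bottom>"
    by (auto simp: orthogonal_comp_def orthogonal_def inner_diff_right)
  show "x - (x - (\<Sum>i\<in>I. (x \<bullet> v i) *\<^sub>R v i)) \<in> ((v ` I)\<^sup>\<bottom>)\<^sup>\<bottom>"
    by (auto simp: orthogonal_comp_def orthogonal_def inner_sum_right inner_commute)
qed

lemma proj_insert:
  assumes "orthonormal_basis J v" "finite J" "insert i I \<subseteq> J" "i \<notin> I"
  shows "proj v (insert i I) = proj v {i} \<circ> proj v I"
proof
  fix x
  have fin: "finite I" using assms(2,3) by (metis finite_subset finite_insert)
  have "v j \<bullet> v i = 0" if "j \<in> I" for j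
  proof -
    have "j \<in> J" "i \<in> J" "j \<noteq> i" using assms(3,4) that by auto
    then show ?thesis using assms(1) by (simp add: orthonormal_basis_def)
  qed
  then have "(\<Sum>j\<in>I. (x \<bullet> v j) *\<^sub>R v j) \<bullet> v i = 0"
    by (simp add: inner_sum_left)
  moreover have "proj v (insert i I) x = x - (\<Sum>j\<in>insert i I. (x \<bullet> v j) *\<^sub>R v j)"
    by (rule proj_eq[OF assms(1-3)])
  moreover have "proj v I x = x - (\<Sum>j\<in>I. (x \<bullet> v j) *\<^sub>R v j)"
    using assms(3) by (intro proj_eq[OF assms(1,2)]) auto
  moreover have "proj v {i} y = y - (y \<bullet> v i) *\<^sub>R v i" for y
    using proj_eq[OF assms(1,2), of "{i}"] assms(3) by simp
  ultimately show "proj v (insert i I) x = (proj v {i} \<circ> proj v I) x"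
    using fin assms(4) by (simp add: inner_diff_left)
qed

end

theory Submission
  imports Defs
begin

text \<open>
  The rhomb is found as a fixed point. For \<open>p \<in> B\<close> the line through \<open>p\<close> in direction \<open>v i\<close> meets
  \<open>B\<close> in a chord; a centre of an inscribed rhomb is exactly a point \<open>p\<close> that is the midpoint of
  each of its \<open>n + 1\<close> chords, provided that none of them is degenerate. Send \<open>p\<close> to the average of
  the \<open>n + 1\<close> chord midpoints. By convexity this maps \<open>B\<close> into \<open>B\<close>, and strict convexity makes it
  continuous up to the boundary (\<open>continuous_on_reach\<close>). Brouwer's theorem gives a fixed point,
  and since the displacements from \<open>p\<close> to the midpoints point in linearly independent
  directions, all of them vanish at the fixed point (\<open>chord_bisecting_point\<close>).

  If one chord through this point is non-degenerate, then the point lies inside it, hence in the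
  interior of \<open>B\<close>, so every chord is non-degenerate and the endpoints form the rhomb. If all
  chords degenerate to the point itself, then it projects to the boundary in every direction
  (\<open>degenerate_chord_proj_boundary\<close>), that is, it is a special corner.
\<close>

section \<open>How far a body extends from a point in a given direction\<close>

definition reach :: "'a::euclidean_space set \<Rightarrow> 'a \<Rightarrow> 'a \<Rightarrow> real" where
  "reach B u p = Sup {t. p + t *\<^sub>R u \<in> B}"

lemma strictly_convex_imp_convex: "convex B" if "strictly_convex B"
  unfolding convex_contains_open_segment
  using that interior_subset unfolding strictly_convex_def by blast

lemma compact_chord_parameters:
  fixes B :: "'a::euclidean_space set"
  assumes "compact B" "u \<noteq> 0"
  shows "compact {t. p + t *\<^sub>R u \<in> B}"
proof -
  obtain K where K: "\<And>x. x \<in> B \<Longrightarrow> norm x \<le> K"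
    using compact_imp_bounded[OF assms(1)] unfolding bounded_iff by blast
  have "\<bar>t\<bar> \<le> (K + norm p) / norm u" if "p + t *\<^sub>R u \<in> B" for t
  proof -
    have "norm (t *\<^sub>R u) \<le> norm (p + t *\<^sub>R u) + norm p"
      by (metis add_diff_cancel_left' norm_triangle_ineq4)
    then show ?thesis using K[OF that] assms(2) by (simp add: pos_le_divide_eq)
  qed
  then have "bounded {t. p + t *\<^sub>R u \<in> B}" unfolding bounded_iff by auto
  moreover have "closed ((\<lambda>t. p + t *\<^sub>R u) -` B)"
    by (intro continuous_closed_vimage compact_imp_closed assms(1) continuous_intros)
  ultimately show ?thesis by (simp add: compact_eq_bounded_closed vimage_def)
qed

lemma reach_upper:
  fixes B :: "'a::euclidean_space set"
  assumes "compact B" "u \<noteq> 0" "p + t *\<^sub>R u \<in> B"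
  shows "t \<le> reach B u p"
  unfolding reach_def
  by (rule cSup_upper)
    (simp_all add: assms(3) bounded_imp_bdd_above compact_imp_bounded compact_chord_parameters assms(1,2))

lemma reach_in:
  fixes B :: "'a::euclidean_space set"
  assumes "compact B" "u \<noteq> 0" "p \<in> B"
  shows "p + reach B u p *\<^sub>R u \<in> B"
proof -
  let ?T = "{t. p + t *\<^sub>R u \<in> B}"
  have "0 \<in> ?T" using assms(3) by simp
  then have "Sup ?T \<in> ?T"
    using compact_chord_parameters[OF assms(1,2), of p]
    by (metis closed_contains_Sup empty_iff bounded_imp_bdd_above compact_imp_bounded compact_imp_closed)
  then show ?thesis by (simp add: reach_def)
qed

lemma reach_nonneg:
  fixes B :: "'a::euclidean_space set"
  assumes "compact B" "u \<noteq> 0" "p \<in> B"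
  shows "0 \<le> reach B u p"
  using reach_upper[OF assms(1,2), of p 0] assms(3) by simp

lemma reach_between_interior:
  fixes B :: "'a::euclidean_space set"
  assumes "compact B" "strictly_convex B" "u \<noteq> 0" "p \<in> B" "0 < s" "s < reach B u p"
  shows "p + s *\<^sub>R u \<in> interior B"
proof -
  let ?q = "p + reach B u p *\<^sub>R u"
  have "p + s *\<^sub>R u \<in> open_segment p ?q"
    unfolding in_segment using assms
    by (intro conjI exI[of _ "s / reach B u p"]) (auto simp: algebra_simps)
  then show ?thesis
    using assms reach_in unfolding strictly_convex_def by blast
qed

lemma reach_pos_interior:
  fixes B :: "'a::euclidean_space set"
  assumes "compact B" "u \<noteq> 0" "p \<in> interior B"
  shows "0 < reach B u p"
proof -
  obtain e where e: "e > 0" "cball p e \<subseteq> B"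
    using assms(3) mem_interior_cball by blast
  have "p + (e / norm u) *\<^sub>R u \<in> B"
    using e assms(2) by (auto simp: mem_cball dist_norm subset_iff)
  then have "e / norm u \<le> reach B u p" by (rule reach_upper[OF assms(1,2)])
  then show ?thesis using e assms(2) by (smt (verit) divide_pos_pos zero_less_norm_iff)
qed

lemma reach_frontier:
  fixes B :: "'a::euclidean_space set"
  assumes "compact B" "u \<noteq> 0" "p \<in> B"
  shows "p + reach B u p *\<^sub>R u \<in> frontier B"
proof -
  let ?q = "p + reach B u p *\<^sub>R u"
  have "?q \<notin> interior B"
  proof
    assume q: "?q \<in> interior B"
    then have "0 < reach B u ?q" by (rule reach_pos_interior[OF assms(1,2)])
    moreover have "?q + reach B u ?q *\<^sub>R u \<in> B"
      by (intro reach_in assms)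
    then have "p + (reach B u p + reach B u ?q) *\<^sub>R u \<in> B" by (simp add: algebra_simps)
    then have "reach B u p + reach B u ?q \<le> reach B u p" by (rule reach_upper[OF assms(1,2)])
    ultimately show False by simp
  qed
  then show ?thesis
    using reach_in[OF assms] closure_subset unfolding frontier_def by blast
qed

text \<open>
  Upper semicontinuity is a matter of compactness alone: for \<open>a \<ge> 0\<close> the points reaching at least
  \<open>a\<close> are those whose translate by \<open>a u\<close> is still in \<open>B\<close>. Lower semicontinuity needs strict
  convexity: any positive \<open>s\<close> short of the reach of \<open>x\<close> leads into the interior, so nearby points
  reach \<open>s\<close> as well. It fails for merely convex bodies, at the boundary.
\<close>

lemma continuous_on_reach:
  fixes B :: "'a::euclidean_space set"
  assumes "compact B" "strictly_convex B" "u \<noteq> 0"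
  shows "continuous_on B (reach B u)"
  unfolding continuous_on_def
proof (intro ballI order_tendstoI)
  fix x a assume x: "x \<in> B" and a: "a < reach B u x"
  show "\<forall>\<^sub>F p in at x within B. a < reach B u p"
  proof (cases "a < 0")
    case True
    then have "a < reach B u p" if "p \<in> B" for p
      using reach_nonneg[OF assms(1,3) that] by linarith
    then show ?thesis by (simp add: eventually_at_filter)
  next
    case False
    define s where "s = (a + reach B u x) / 2"
    have s: "a < s" "0 < s" "s < reach B u x" using False a by (auto simp: s_def)
    have "open ((\<lambda>p. p + s *\<^sub>R u) -` interior B)"
      by (intro continuous_open_vimage open_interior continuous_intros)
    moreover have "x \<in> (\<lambda>p. p + s *\<^sub>R u) -` interior B"
      using reach_between_interior[OF assms x s(2,3)] by simp
    ultimately have "\<forall>\<^sub>F p in at x within B. p \<in> (\<lambda>p. p + s *\<^sub>R u) -` interior B"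
      unfolding eventually_at_topological by blast
    then show ?thesis
    proof eventually_elim
      case (elim p)
      then have "p + s *\<^sub>R u \<in> B" using interior_subset by auto
      then show ?case using reach_upper[OF assms(1,3)] s(1) by force
    qed
  qed
next
  fix x a assume x: "x \<in> B" and a: "reach B u x < a"
  have "open ((\<lambda>p. p + a *\<^sub>R u) -` (- B))"
    by (intro continuous_open_vimage continuous_intros open_Compl compact_imp_closed assms(1))
  moreover have "x + a *\<^sub>R u \<notin> B" using reach_upper[OF assms(1,3), of x a] a by auto
  ultimately have "\<forall>\<^sub>F p in at x within B. p \<in> (\<lambda>p. p + a *\<^sub>R u) -` (- B)"
    unfolding eventually_at_topological by blast
  moreover have "\<forall>\<^sub>F p in at x within B. p \<in> B" by (simp add: eventually_at_filter)
  ultimately show "\<forall>\<^sub>F p in at x within B. reach B u p < a"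
  proof eventually_elim
    case (elim p)
    have pos: "0 < a" using reach_nonneg[OF assms(1,3) x] a by linarith
    show ?case
    proof (rule ccontr)
      assume "\<not> ?case"
      then have le: "a \<le> reach B u p" by simp
      show False
      proof (cases "a = reach B u p")
        case True
        then show ?thesis using reach_in[OF assms(1,3)] elim by auto
      next
        case False
        then have "p + a *\<^sub>R u \<in> interior B"
          using le pos elim by (intro reach_between_interior assms) auto
        then show ?thesis using elim interior_subset by auto
      qed
    qed
  qed
qed

section \<open>A point bisecting all of its chords\<close>

lemma chord_bisecting_point:
  fixes B :: "'a::euclidean_space set" and v :: "'i \<Rightarrow> 'a"
  assumes "compact B" "strictly_convex B" "B \<noteq> {}"
    and "finite J" "J \<noteq> {}"
    and on: "\<And>i j. i \<in> J \<Longrightarrow> j \<in> J \<Longrightarrow> v i \<bullet> v j = (if i = j then 1 else 0)"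
  obtains p where "p \<in> B" "\<And>i. i \<in> J \<Longrightarrow> reach B (v i) p = reach B (- v i) p"
proof -
  define d where "d = (\<lambda>i p. (reach B (v i) p - reach B (- v i) p) / 2)"
  define G where "G = (\<lambda>p. \<Sum>i\<in>J. (1 / card J) *\<^sub>R (p + d i p *\<^sub>R v i))"
  have cJ: "card J > 0" using assms(4,5) by (simp add: card_gt_0_iff)
  have nz: "v i \<noteq> 0" "- v i \<noteq> 0" if "i \<in> J" for i using on[OF that that] by auto
  have conv: "convex B" by (rule strictly_convex_imp_convex[OF assms(2)])
  have mid: "p + d i p *\<^sub>R v i \<in> B" if "p \<in> B" "i \<in> J" for p i
  proof -
    let ?q = "p + reach B (v i) p *\<^sub>R v i" and ?r = "p + reach B (- v i) p *\<^sub>R (- v i)"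
    have "(1/2) *\<^sub>R ?q + (1/2) *\<^sub>R ?r \<in> B"
      using nz[OF that(2)] that(1) by (intro convexD[OF conv] reach_in assms) auto
    moreover have "(1/2) *\<^sub>R ?q + (1/2) *\<^sub>R ?r = ((1/2) *\<^sub>R p + (1/2) *\<^sub>R p) + d i p *\<^sub>R v i"
      by (simp add: d_def algebra_simps diff_divide_distrib)
    moreover have "(1/2) *\<^sub>R p + (1/2) *\<^sub>R p = p" by (simp flip: scaleR_add_left)
    ultimately show ?thesis by simp
  qed
  have "G p \<in> B" if "p \<in> B" for p
    unfolding G_def using cJ assms(4) mid that by (intro convex_sum[OF _ conv]) auto
  moreover have "continuous_on B G"
    unfolding G_def d_def
    using nz by (intro continuous_intros continuous_on_reach assms) auto
  ultimately obtain p where p: "p \<in> B" "G p = p"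
    using brouwer[OF assms(1) conv assms(3)] by (metis Pi_I)
  have "G p = p + (1 / card J) *\<^sub>R (\<Sum>i\<in>J. d i p *\<^sub>R v i)"
    using cJ by (simp add: G_def scaleR_right_distrib sum.distrib scaleR_sum_right sum_constant_scaleR)
  then have z: "(\<Sum>i\<in>J. d i p *\<^sub>R v i) = 0" using p(2) cJ assms(5) by simp
  have "d j p = 0" if j: "j \<in> J" for j
  proof -
    have "(\<Sum>i\<in>J. d i p *\<^sub>R v i) \<bullet> v j = (\<Sum>i\<in>J. if j = i then d i p else 0)"
      unfolding inner_sum_left using on j by (intro sum.cong) auto
    then show ?thesis using z j assms(4) by simp
  qed
  then show ?thesis using that[OF p(1)] by (simp add: d_def)
qed

section \<open>Degenerate chords lie over the boundary of the projection\<close>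

text \<open>
  If the projection of \<open>x\<close> were interior to the projection of \<open>B\<close>, the segment from the projection
  of another point \<open>b \<in> B\<close> could be prolonged slightly beyond that of \<open>x\<close>. A point \<open>z \<in> B\<close> above
  its end gives a segment from \<open>b\<close> to \<open>z\<close> passing over the projection of \<open>x\<close> through an interior
  point of \<open>B\<close>, so the chord there is not degenerate.
\<close>

lemma degenerate_chord_proj_boundary:
  fixes B :: "'a::euclidean_space set"
  assumes "strictly_convex B" "x \<in> B" "b \<in> B" "b \<noteq> x"
    and ob: "orthonormal_basis J v" "finite J" "i \<in> J"
    and deg: "\<And>t. x + t *\<^sub>R v i \<in> B \<Longrightarrow> t = 0"
  shows "proj v {i} x \<in> proj_boundary v {i} B"
proof -
  let ?P = "proj v {i}" and ?W = "(v ` {i})\<^sup>\<bottom>"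
  have P: "?P y = y - (y \<bullet> v i) *\<^sub>R v i" for y
    using proj_eq[OF ob(1,2), of "{i}"] ob(3) by simp
  have vi: "v i \<bullet> v i = 1" using ob(1,3) by (simp add: orthonormal_basis_def)
  have W: "?P y \<in> ?W" for y
    by (simp add: P orthogonal_comp_def orthogonal_def inner_diff_right vi inner_commute)
  have fibre: "y = x" if "y \<in> B" "?P y = ?P x" for y
  proof -
    have "y = x + (y \<bullet> v i - x \<bullet> v i) *\<^sub>R v i" using that(2) by (simp add: P algebra_simps)
    then show ?thesis using deg that(1) by (metis add.right_neutral scaleR_zero_left)
  qed
  have "?P x \<notin> top_of_set ?W interior_of (?P ` B)"
  proof
    assume "?P x \<in> top_of_set ?W interior_of (?P ` B)"
    then obtain U where U: "openin (top_of_set ?W) U" "?P x \<in> U" "U \<subseteq> ?P ` B"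
      unfolding interior_of_def by blast
    then obtain O' where O': "open O'" "U = ?W \<inter> O'" by (auto simp: openin_open)
    define y where "y = (\<lambda>s. x + s *\<^sub>R (x - b))"
    have "open ((\<lambda>s. ?P (y s)) -` O')"
      unfolding P y_def by (intro continuous_open_vimage O'(1) continuous_intros)
    moreover have "0 \<in> (\<lambda>s. ?P (y s)) -` O'" using U(2) O'(2) by (simp add: y_def)
    ultimately obtain e where e: "e > 0" "cball 0 e \<subseteq> (\<lambda>s. ?P (y s)) -` O'"
      using open_contains_cball by blast
    then have "?P (y e) \<in> U" using W O'(2) by (auto simp: subset_iff)
    then obtain z where z: "z \<in> B" "?P z = ?P (y e)" using U(3) by auto
    define w where "w = (1 - 1 / (1 + e)) *\<^sub>R b + (1 / (1 + e)) *\<^sub>R z"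
    have lin: "?P (r *\<^sub>R c + s *\<^sub>R c') = r *\<^sub>R ?P c + s *\<^sub>R ?P c'" for r s c c'
      by (simp add: P algebra_simps inner_add_left)
    have "?P w = ?P ((1 - 1 / (1 + e)) *\<^sub>R b + (1 / (1 + e)) *\<^sub>R y e)"
      unfolding w_def lin z(2) ..
    moreover have "(1 - 1 / (1 + e)) *\<^sub>R b + (1 / (1 + e)) *\<^sub>R y e = x"
    proof -
      have "(1 - 1 / (1 + e)) *\<^sub>R b + (1 / (1 + e)) *\<^sub>R y e
          = (1 - 1 / (1 + e) - e / (1 + e)) *\<^sub>R b + (1 / (1 + e) + e / (1 + e)) *\<^sub>R x"
        by (simp add: y_def algebra_simps)
      moreover have "1 / (1 + e) + e / (1 + e) = 1" using e(1) by (simp flip: add_divide_distrib)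
      ultimately show ?thesis by (simp add: diff_diff_eq)
    qed
    ultimately have Pw: "?P w = ?P x" by simp
    have "z \<noteq> b"
    proof
      assume "z = b"
      then have "w = b" by (simp add: w_def flip: scaleR_add_left)
      then show False using fibre[OF assms(3)] Pw assms(4) by simp
    qed
    then have "w \<in> open_segment b z"
      unfolding in_segment w_def using e(1)
      by (intro conjI exI[of _ "1 / (1 + e)"]) auto
    then have w: "w \<in> interior B"
      using assms(1,3) z(1) unfolding strictly_convex_def by blast
    then have "w = x" using fibre[of w] Pw interior_subset by blast
    then obtain r where r: "r > 0" "cball x r \<subseteq> B" using w mem_interior_cball by blast
    have "norm (v i) = 1" using vi by (simp add: norm_eq_1)
    then have "x + r *\<^sub>R v i \<in> B" using r by (auto simp: subset_iff dist_norm)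
    then show False using deg r(1) by auto
  qed
  moreover have "?P x \<in> top_of_set ?W closure_of (?P ` B)"
    using W assms(2) closure_of_subset[of "?P ` B" "top_of_set ?W"] by auto
  ultimately show ?thesis unfolding proj_boundary_def frontier_of_def by blast
qed

section \<open>Inscribing the rhomb\<close>

theorem mainTheorem1:
  fixes n :: nat
    and f :: "real ^ 'm \<Rightarrow> real ^ 'm"
    and B S :: "(real ^ 'm) set"
    and v :: "nat \<Rightarrow> real ^ 'm"
  assumes "n \<ge> 1" and "CARD('m) = n + 1"
    and "strictly_convex_embedding f" and "B = f ` cball 0 1"
    and "S = frontier B"
    and "orthonormal_basis {1..n+1} v"
    and "regular_wrt n v B"
    and "\<not> (\<exists>x. special_corner n v B x)"
  shows "\<exists>(p :: real ^ 'm) (l :: nat \<Rightarrow> real).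
           \<forall>i\<in>{1..n+1}. l i > 0 \<and> p + l i *\<^sub>R v i \<in> S \<and> p - l i *\<^sub>R v i \<in> S"
proof -
  let ?J = "{1..n+1}"
  have emb: "embedding_map (top_of_set (cball 0 1)) euclidean f" and sc: "strictly_convex B"
    using assms(3,4) by (auto simp: strictly_convex_embedding_def)
  have cont: "continuous_on (cball 0 1) f"
    using emb unfolding embedding_map_def
    by (auto dest!: homeomorphic_imp_continuous_map simp: continuous_map_in_subtopology)
  have inj: "inj_on f (cball 0 1)"
    using emb unfolding embedding_map_def
    by (auto dest!: homeomorphic_imp_injective_map)
  have comp: "compact B"
    unfolding assms(4) by (intro compact_continuous_image cont compact_cball)
  have on: "v i \<bullet> v j = (if i = j then 1 else 0)" if "i \<in> ?J" "j \<in> ?J" for i j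
    using assms(6) that unfolding orthonormal_basis_def by blast
  have nz: "v i \<noteq> 0" "- v i \<noteq> 0" if "i \<in> ?J" for i using on[OF that that] by auto
  have "B \<noteq> {}" "?J \<noteq> {}" by (auto simp: assms(4))
  then obtain p where p: "p \<in> B" and eq: "\<And>i. i \<in> ?J \<Longrightarrow> reach B (v i) p = reach B (- v i) p"
    using chord_bisecting_point[OF comp sc _ _ _ on] by blast
  have int: "p \<in> interior B"
  proof (rule ccontr)
    assume np: "p \<notin> interior B"
    have zero: "reach B (v i) p = 0" if i: "i \<in> ?J" for i
    proof (rule ccontr)
      define h where "h = reach B (v i) p"
      assume "reach B (v i) p \<noteq> 0"
      then have h: "h > 0" using reach_nonneg[OF comp nz(1)[OF i] p] by (simp add: h_def)
      let ?q = "p + h *\<^sub>R v i" and ?r = "p + h *\<^sub>R (- v i)"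
      have "?q \<in> B" using reach_in[OF comp nz(1)[OF i] p] by (simp add: h_def)
      moreover have "?r \<in> B" using reach_in[OF comp nz(2)[OF i] p] eq[OF i] by (simp add: h_def)
      moreover have "p \<in> open_segment ?q ?r"
      proof -
        have "midpoint ?q ?r = p" by (simp add: midpoint_def flip: scaleR_2)
        moreover have "?q \<noteq> ?r"
        proof
          assume "?q = ?r"
          then have "?q - p = ?r - p" by simp
          then have "(2 * h) *\<^sub>R v i = 0"
            by (metis add_diff_cancel_left' add.left_inverse add_diff_cancel diff_0 eq_neg_iff_add_eq_0 mult_2 scaleR_add_left scaleR_minus_right)
          then show False using h nz(1)[OF i] by simp
        qed
        ultimately show ?thesis using midpoint_in_open_segment by metis
      qed
      ultimately show False using sc np unfolding strictly_convex_def by blast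
    qed
    obtain b where b: "b \<in> B" "b \<noteq> p"
    proof -
      have "v 1 \<in> cball 0 1" "v 1 \<noteq> 0"
        using on[of 1 1] nz(1)[of 1] by (auto simp: norm_eq_sqrt_inner)
      then have "f (v 1) \<noteq> f 0" using inj by (auto dest: inj_onD)
      moreover have "f (v 1) \<in> B" "f 0 \<in> B" using \<open>v 1 \<in> cball 0 1\<close> by (auto simp: assms(4))
      ultimately show ?thesis using that by metis
    qed
    have "proj v {i} p \<in> proj_boundary v {i} B" if i: "i \<in> ?J" for i
    proof (rule degenerate_chord_proj_boundary[OF sc p b assms(6) _ i])
      fix t assume t: "p + t *\<^sub>R v i \<in> B"
      have "t \<le> 0" using reach_upper[OF comp nz(1)[OF i] t] zero[OF i] by simp
      moreover have "- t \<le> 0"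
        using reach_upper[OF comp nz(2)[OF i], of p "- t"] t zero[OF i] eq[OF i] by simp
      ultimately show "t = 0" by simp
    qed simp
    then show False using assms(8) p by (auto simp: special_corner_def)
  qed
  have "0 < reach B (v i) p \<and> p + reach B (v i) p *\<^sub>R v i \<in> S \<and> p - reach B (v i) p *\<^sub>R v i \<in> S"
    if i: "i \<in> ?J" for i
    using reach_pos_interior[OF comp nz(1)[OF i] int] reach_frontier[OF comp nz(1)[OF i] p]
      reach_frontier[OF comp nz(2)[OF i] p] eq[OF i] assms(5)
    by simp
  then show ?thesis by (intro exI[of _ p] exI[of _ "\<lambda>i. reach B (v i) p"]) blast
qed

end
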